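(* (1) Let $(A, \prec_{\Omega}, \succ_{\Omega},p)$ be a matching Hom-dendriform algebra. Then $(A, \cdot_{\Omega}, p)$ is a compatible Hom-associative algebra, where $$\cdot_{\omega}: A \otimes A \rightarrow A, \quad x \cdot_{\omega} y:= x \prec_{\omega}y+ x \succ_{\omega} y \quad \text{for } x,y \in A \text{ and } \omega \in \Omega.$$ (2) Let $(A, \prec_{\Omega}, \bullet_{\Omega}, \succ_{\Omega},p)$ be a matching Hom-tridendriform algebra. Then $(A, \cdot_{\Omega}, p)$ is a compatible Hom-associative algebra, where $$\cdot_{\omega}: A \otimes A \rightarrow A, \quad x \cdot_{\omega} y:= x \prec_{\omega}y+ x \bullet_{\omega} y+ x \succ_{\omega} y \quad \text{for } x,y \in A \text{ and } \omega \in \Omega.$$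
   Context: Let $\mathbf{k}$ be a unitary commutative ring, the base ring of all modules and linear maps, and let $\Omega$ be a nonempty set; a subscript $\Omega$ denotes a family indexed by $\Omega$, e.g. $\prec_\Omega=(\prec_\omega)_{\omega\in\Omega}$. A matching Hom-dendriform algebra $(A,\prec_\Omega,\succ_\Omega,p)$ is a $\mathbf{k}$-module $A$ with bilinear operations $\prec_\omega,\succ_\omega: A\otimes A\to A$ ($\omega\in\Omega$) and a linear map $p:A\to A$ such that for all $x,y,z\in A$, $\alpha,\beta\in\Omega$: $$(x \prec_{\alpha} y) \prec_{\beta} p(z)= p(x) \prec_{\alpha} (y \prec_{\beta} z)+ p(x) \prec_{\beta} (y \succ_{\alpha} z),$$ $$(x \succ_{\alpha} y) \prec_{\beta} p(z)= p(x) \succ_{\alpha} (y \prec_{\beta} z),$$ $$(x \prec_{\beta} y) \succ_{\alpha} p(z)+ (x \succ_{\alpha} y) \succ_{\beta} p(z) = p(x) \succ_{\alpha} (y \succ_{\beta} z).$$ A matching Hom-tridendriform algebra $(A,\prec_\Omega,\bullet_\Omega,\succ_\Omega,p)$ is a $\mathbf{k}$-module $A$ with bilinear operations $\prec_\omega,\bullet_\omega,\succ_\omega$ ($\omega\in\Omega$) and a linear map $p:A\to A$ such that for all $x,y,z\in A$, $\alpha,\beta\in\Omega$: $$(x \prec_{\alpha} y) \prec_{\beta} p(z) = p(x) \prec_{\alpha} (y \prec_{\beta} z)+ p(x) \prec_{\beta} (y \succ_{\alpha} z)+ p(x) \prec_{\alpha} (y \bullet_{\beta} z),$$ $$(x \succ_{\alpha}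 y) \prec_{\beta} p(z) = p(x) \succ_{\alpha} (y \prec_{\beta} z),$$ $$p(x) \succ_{\alpha} (y \succ_{\beta} z) = (x \prec_{\beta} y) \succ_{\alpha} p(z) + (x \succ_{\alpha} y) \succ_{\beta} p(z)+(x \bullet_{\beta} y) \succ_{\alpha} p(z),$$ $$(x \succ_{\alpha} y) \bullet_{\beta} p(z)= p(x) \succ_{\alpha} (y \bullet_{\beta} z),\qquad (x \prec_{\alpha} y) \bullet_{\beta} p(z)= p(x) \bullet_{\beta}(y \succ_{\alpha} z),$$ $$(x \bullet_{\alpha} y) \prec_{\beta} p(z)= p(x) \bullet_{\alpha} (y \prec_{\beta} z),\qquad (x \bullet_{\alpha} y) \bullet_{\beta} p(z) = p(x) \bullet_{\alpha} (y \bullet_{\beta} z).$$ A compatible Hom-associative algebra $(A,\cdot_\Omega,p)$ is a $\mathbf{k}$-module $A$ with bilinear operations $\cdot_\omega:A\otimes A\to A$ ($\omega\in\Omega$) and a linear map $p:A\to A$ such that for all $x,y,z\in A$, $\alpha,\beta\in\Omega$: $$(x \cdot_{\alpha} y) \cdot_{\beta} p(z) + (x \cdot_{\beta} y) \cdot_{\alpha} p(z)=p(x) \cdot_{\alpha}(y \cdot_{\beta} z)+ p(x) \cdot_{\beta} (y \cdot_{\alpha} z).$$ *)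

theory Defs
  imports "HOL-Algebra.Module"
begin

text \<open>
  The base ring is a commutative unital ring \<open>R\<close> (the zero ring is allowed) and an algebra
  is carried by an \<open>R\<close>-module \<open>M\<close>. The \<open>mult\<close> and \<open>one\<close> fields that the
  record type of modules inherits from rings are never used.

  Bilinear maps out of a Cartesian product stand for linear maps out of the tensor square.
  A family of operations is a curried function whose first argument is the index:
  \<open>prec \<omega> x y\<close> is $x \prec_\omega y$. Only indices in \<open>\<Omega>\<close> and arguments in
  \<open>carrier M\<close> are constrained.
\<close>

definition linear_endo ::
  "('r, 'x) ring_scheme \<Rightarrow> ('r, 'a, 'm) module_scheme \<Rightarrow> ('a \<Rightarrow> 'a) \<Rightarrow> bool" where
  "linear_endo R M p \<longleftrightarrow>
     p \<in> carrier M \<rightarrow> carrier M \<and>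
     (\<forall>x\<in>carrier M. \<forall>y\<in>carrier M. p (x \<oplus>\<^bsub>M\<^esub> y) = p x \<oplus>\<^bsub>M\<^esub> p y) \<and>
     (\<forall>c\<in>carrier R. \<forall>x\<in>carrier M. p (c \<odot>\<^bsub>M\<^esub> x) = c \<odot>\<^bsub>M\<^esub> p x)"

definition bilinear_op ::
  "('r, 'x) ring_scheme \<Rightarrow> ('r, 'a, 'm) module_scheme \<Rightarrow> ('a \<Rightarrow> 'a \<Rightarrow> 'a) \<Rightarrow> bool" where
  "bilinear_op R M f \<longleftrightarrow>
     (\<forall>x\<in>carrier M. linear_endo R M (\<lambda>y. f x y)) \<and>
     (\<forall>y\<in>carrier M. linear_endo R M (\<lambda>x. f x y))"

locale matching_Hom_dendriform_algebra = module R M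
  for R :: "('r, 'x) ring_scheme" (structure) and M :: "('r, 'a, 'm) module_scheme" (structure) +
  fixes \<Omega> :: "'i set"
    and prec succ :: "'i \<Rightarrow> 'a \<Rightarrow> 'a \<Rightarrow> 'a"
    and p :: "'a \<Rightarrow> 'a"
  assumes linear_p: "linear_endo R M p"
    and bilinear_prec: "\<omega> \<in> \<Omega> \<Longrightarrow> bilinear_op R M (prec \<omega>)"
    and bilinear_succ: "\<omega> \<in> \<Omega> \<Longrightarrow> bilinear_op R M (succ \<omega>)"
    and prec_prec:
      "\<lbrakk>\<alpha> \<in> \<Omega>; \<beta> \<in> \<Omega>; x \<in> carrier M; y \<in> carrier M; z \<in> carrier M\<rbrakk> \<Longrightarrow>
       prec \<beta> (prec \<alpha> x y) (p z) =
         prec \<alpha> (p x) (prec \<beta> y z) \<oplus>\<^bsub>M\<^esub> prec \<beta> (p x) (succ \<alpha> y z)"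
    and succ_prec:
      "\<lbrakk>\<alpha> \<in> \<Omega>; \<beta> \<in> \<Omega>; x \<in> carrier M; y \<in> carrier M; z \<in> carrier M\<rbrakk> \<Longrightarrow>
       prec \<beta> (succ \<alpha> x y) (p z) = succ \<alpha> (p x) (prec \<beta> y z)"
    and succ_succ:
      "\<lbrakk>\<alpha> \<in> \<Omega>; \<beta> \<in> \<Omega>; x \<in> carrier M; y \<in> carrier M; z \<in> carrier M\<rbrakk> \<Longrightarrow>
       succ \<alpha> (prec \<beta> x y) (p z) \<oplus>\<^bsub>M\<^esub> succ \<beta> (succ \<alpha> x y) (p z) =
         succ \<alpha> (p x) (succ \<beta> y z)"

locale matching_Hom_tridendriform_algebra = module R M
  for R :: "('r, 'x) ring_scheme" (structure) and M :: "('r, 'a, 'm) module_scheme" (structure) +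
  fixes \<Omega> :: "'i set"
    and prec bullet succ :: "'i \<Rightarrow> 'a \<Rightarrow> 'a \<Rightarrow> 'a"
    and p :: "'a \<Rightarrow> 'a"
  assumes linear_p: "linear_endo R M p"
    and bilinear_prec: "\<omega> \<in> \<Omega> \<Longrightarrow> bilinear_op R M (prec \<omega>)"
    and bilinear_bullet: "\<omega> \<in> \<Omega> \<Longrightarrow> bilinear_op R M (bullet \<omega>)"
    and bilinear_succ: "\<omega> \<in> \<Omega> \<Longrightarrow> bilinear_op R M (succ \<omega>)"
    and prec_prec:
      "\<lbrakk>\<alpha> \<in> \<Omega>; \<beta> \<in> \<Omega>; x \<in> carrier M; y \<in> carrier M; z \<in> carrier M\<rbrakk> \<Longrightarrow>
       prec \<beta> (prec \<alpha> x y) (p z) =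
         prec \<alpha> (p x) (prec \<beta> y z) \<oplus>\<^bsub>M\<^esub> prec \<beta> (p x) (succ \<alpha> y z)
           \<oplus>\<^bsub>M\<^esub> prec \<alpha> (p x) (bullet \<beta> y z)"
    and succ_prec:
      "\<lbrakk>\<alpha> \<in> \<Omega>; \<beta> \<in> \<Omega>; x \<in> carrier M; y \<in> carrier M; z \<in> carrier M\<rbrakk> \<Longrightarrow>
       prec \<beta> (succ \<alpha> x y) (p z) = succ \<alpha> (p x) (prec \<beta> y z)"
    and succ_succ:
      "\<lbrakk>\<alpha> \<in> \<Omega>; \<beta> \<in> \<Omega>; x \<in> carrier M; y \<in> carrier M; z \<in> carrier M\<rbrakk> \<Longrightarrow>
       succ \<alpha> (p x) (succ \<beta> y z) =
         succ \<alpha> (prec \<beta> x y) (p z) \<oplus>\<^bsub>M\<^esub> succ \<beta> (succ \<alpha> x y) (p z)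
           \<oplus>\<^bsub>M\<^esub> succ \<alpha> (bullet \<beta> x y) (p z)"
    and succ_bullet:
      "\<lbrakk>\<alpha> \<in> \<Omega>; \<beta> \<in> \<Omega>; x \<in> carrier M; y \<in> carrier M; z \<in> carrier M\<rbrakk> \<Longrightarrow>
       bullet \<beta> (succ \<alpha> x y) (p z) = succ \<alpha> (p x) (bullet \<beta> y z)"
    and prec_bullet:
      "\<lbrakk>\<alpha> \<in> \<Omega>; \<beta> \<in> \<Omega>; x \<in> carrier M; y \<in> carrier M; z \<in> carrier M\<rbrakk> \<Longrightarrow>
       bullet \<beta> (prec \<alpha> x y) (p z) = bullet \<beta> (p x) (succ \<alpha> y z)"
    and bullet_prec:
      "\<lbrakk>\<alpha> \<in> \<Omega>; \<beta> \<in> \<Omega>; x \<in> carrier M; y \<in> carrier M; z \<in> carrier M\<rbrakk> \<Longrightarrow>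
       prec \<beta> (bullet \<alpha> x y) (p z) = bullet \<alpha> (p x) (prec \<beta> y z)"
    and bullet_bullet:
      "\<lbrakk>\<alpha> \<in> \<Omega>; \<beta> \<in> \<Omega>; x \<in> carrier M; y \<in> carrier M; z \<in> carrier M\<rbrakk> \<Longrightarrow>
       bullet \<beta> (bullet \<alpha> x y) (p z) = bullet \<alpha> (p x) (bullet \<beta> y z)"

locale compatible_Hom_associative_algebra = module R M
  for R :: "('r, 'x) ring_scheme" (structure) and M :: "('r, 'a, 'm) module_scheme" (structure) +
  fixes \<Omega> :: "'i set"
    and dot :: "'i \<Rightarrow> 'a \<Rightarrow> 'a \<Rightarrow> 'a"
    and p :: "'a \<Rightarrow> 'a"
  assumes linear_p: "linear_endo R M p"
    and bilinear_dot: "\<omega> \<in> \<Omega> \<Longrightarrow> bilinear_op R M (dot \<omega>)"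
    and compatible_Hom_assoc:
      "\<lbrakk>\<alpha> \<in> \<Omega>; \<beta> \<in> \<Omega>; x \<in> carrier M; y \<in> carrier M; z \<in> carrier M\<rbrakk> \<Longrightarrow>
       dot \<beta> (dot \<alpha> x y) (p z) \<oplus>\<^bsub>M\<^esub> dot \<alpha> (dot \<beta> x y) (p z) =
         dot \<alpha> (p x) (dot \<beta> y z) \<oplus>\<^bsub>M\<^esub> dot \<beta> (p x) (dot \<alpha> y z)"

end

theory Submission
  imports Defs
begin

text \<open>
  Expand $(x \cdot_\alpha y) \cdot_\beta p(z)$ and $p(x) \cdot_\alpha (y \cdot_\beta z)$ by
  bilinearity and rewrite with the axioms. The two expansions then agree term by term up to the
  position of the indices. The axioms that keep \<open>\<alpha>\<close> on the left operation and \<open>\<beta>\<close> on the right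
  one give terms common to both. The axioms for $\prec\prec$ and $\succ\succ$, and in the
  tridendriform case also $(x \prec_\alpha y) \bullet_\beta p(z) = p(x) \bullet_\beta (y \succ_\alpha z)$,
  carry indices along with the arguments instead: the left expansion contains
  $p(x) \prec_\beta (y \succ_\alpha z)$ and $(x \prec_\alpha y) \succ_\beta p(z)$ where the right
  one contains $p(x) \prec_\alpha (y \succ_\beta z)$ and $(x \prec_\beta y) \succ_\alpha p(z)$,
  and similarly for the terms with \<open>\<bullet>\<close>. These discrepancies are interchanged by swapping \<open>\<alpha>\<close>
  and \<open>\<beta>\<close>, so they cancel in the symmetrised identity, which is compatible
  Hom-associativity.
\<close>

lemma linear_endo_closed:
  assumes "linear_endo R M f" "x \<in> carrier M"
  shows "f x \<in> carrier M"
  using assms unfolding linear_endo_def by auto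

lemma bilinear_op_closed:
  assumes "bilinear_op R M f" "x \<in> carrier M" "y \<in> carrier M"
  shows "f x y \<in> carrier M"
  using assms linear_endo_closed unfolding bilinear_op_def by metis

lemma bilinear_op_add_left:
  assumes "bilinear_op R M f" "x \<in> carrier M" "y \<in> carrier M" "z \<in> carrier M"
  shows "f (x \<oplus>\<^bsub>M\<^esub> y) z = f x z \<oplus>\<^bsub>M\<^esub> f y z"
  using assms unfolding bilinear_op_def linear_endo_def by auto

lemma bilinear_op_add_right:
  assumes "bilinear_op R M f" "x \<in> carrier M" "y \<in> carrier M" "z \<in> carrier M"
  shows "f x (y \<oplus>\<^bsub>M\<^esub> z) = f x y \<oplus>\<^bsub>M\<^esub> f x z"
  using assms unfolding bilinear_op_def linear_endo_def by auto

lemma (in module) linear_endo_add: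
  assumes f: "linear_endo R M f" and g: "linear_endo R M g"
  shows "linear_endo R M (\<lambda>x. f x \<oplus>\<^bsub>M\<^esub> g x)"
proof -
  note closed = linear_endo_closed[OF f] linear_endo_closed[OF g]
  show ?thesis
    using f g unfolding linear_endo_def
    by (auto simp: closed M.a_ac smult_r_distr)
qed

lemma (in module) bilinear_op_add:
  assumes "bilinear_op R M f" and "bilinear_op R M g"
  shows "bilinear_op R M (\<lambda>x y. f x y \<oplus>\<^bsub>M\<^esub> g x y)"
  using assms linear_endo_add unfolding bilinear_op_def by auto

theorem (in matching_Hom_dendriform_algebra) compatible_Hom_associative_sum:
  "compatible_Hom_associative_algebra R M \<Omega> (\<lambda>\<omega> x y. prec \<omega> x y \<oplus>\<^bsub>M\<^esub> succ \<omega> x y) p"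
proof unfold_locales
  show "linear_endo R M p" by (rule linear_p)
  show "bilinear_op R M (\<lambda>x y. prec \<omega> x y \<oplus>\<^bsub>M\<^esub> succ \<omega> x y)" if "\<omega> \<in> \<Omega>" for \<omega>
    using that by (intro bilinear_op_add bilinear_prec bilinear_succ)
  define dot where "dot = (\<lambda>\<omega> x y. prec \<omega> x y \<oplus>\<^bsub>M\<^esub> succ \<omega> x y)"
  fix \<alpha> \<beta> x y z
  assume idx: "\<alpha> \<in> \<Omega>" "\<beta> \<in> \<Omega>"
    and car: "x \<in> carrier M" "y \<in> carrier M" "z \<in> carrier M"
  note [simp] = car linear_endo_closed[OF linear_p]
  have [simp]:
    "prec \<omega> a b \<in> carrier M" "succ \<omega> a b \<in> carrier M"
    if "\<omega> \<in> \<Omega>" "a \<in> carrier M" "b \<in> carrier M" for \<omega> a b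
    using that bilinear_prec bilinear_succ by (auto intro: bilinear_op_closed)
  note biadditive =
    bilinear_op_add_left[OF bilinear_prec] bilinear_op_add_left[OF bilinear_succ]
    bilinear_op_add_right[OF bilinear_prec] bilinear_op_add_right[OF bilinear_succ]
  \<comment> \<open>The axiom for \<open>\<succ>\<succ>\<close> has two terms with different outer indices on its left-hand side,
    of which the expansion of \<open>left\<close> contains only one. So the common normal form of both
    expansions keeps the products of shape \<open>(x \<star> y) \<succ> p z\<close> and moves all other
    brackets to the right.\<close>
  have left: "dot \<nu> (dot \<mu> x y) (p z) =
      prec \<mu> (p x) (prec \<nu> y z) \<oplus>\<^bsub>M\<^esub> prec \<nu> (p x) (succ \<mu> y z) \<oplus>\<^bsub>M\<^esub> succ \<mu> (p x) (prec \<nu> y z)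
      \<oplus>\<^bsub>M\<^esub> succ \<nu> (prec \<mu> x y) (p z) \<oplus>\<^bsub>M\<^esub> succ \<nu> (succ \<mu> x y) (p z)"
    if "\<mu> \<in> \<Omega>" "\<nu> \<in> \<Omega>" for \<mu> \<nu>
    using that by (simp add: dot_def biadditive prec_prec succ_prec M.a_ac)
  have right: "dot \<mu> (p x) (dot \<nu> y z) =
      prec \<mu> (p x) (prec \<nu> y z) \<oplus>\<^bsub>M\<^esub> prec \<mu> (p x) (succ \<nu> y z) \<oplus>\<^bsub>M\<^esub> succ \<mu> (p x) (prec \<nu> y z)
      \<oplus>\<^bsub>M\<^esub> succ \<mu> (prec \<nu> x y) (p z) \<oplus>\<^bsub>M\<^esub> succ \<nu> (succ \<mu> x y) (p z)"
    if "\<mu> \<in> \<Omega>" "\<nu> \<in> \<Omega>" for \<mu> \<nu>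
    using that by (simp add: dot_def biadditive succ_succ[symmetric] M.a_ac)
  show "dot \<beta> (dot \<alpha> x y) (p z) \<oplus>\<^bsub>M\<^esub> dot \<alpha> (dot \<beta> x y) (p z) =
      dot \<alpha> (p x) (dot \<beta> y z) \<oplus>\<^bsub>M\<^esub> dot \<beta> (p x) (dot \<alpha> y z)"
    using idx by (simp add: left right M.a_ac)
qed

theorem (in matching_Hom_tridendriform_algebra) compatible_Hom_associative_sum:
  "compatible_Hom_associative_algebra R M \<Omega>
    (\<lambda>\<omega> x y. prec \<omega> x y \<oplus>\<^bsub>M\<^esub> bullet \<omega> x y \<oplus>\<^bsub>M\<^esub> succ \<omega> x y) p"
proof unfold_locales
  show "linear_endo R M p" by (rule linear_p)
  show "bilinear_op R M (\<lambda>x y. prec \<omega> x y \<oplus>\<^bsub>M\<^esub> bullet \<omega> x y \<oplus>\<^bsub>M\<^esub> succ \<omega> x y)"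
    if "\<omega> \<in> \<Omega>" for \<omega>
    using that by (intro bilinear_op_add bilinear_prec bilinear_bullet bilinear_succ)
  define dot where "dot = (\<lambda>\<omega> x y. prec \<omega> x y \<oplus>\<^bsub>M\<^esub> bullet \<omega> x y \<oplus>\<^bsub>M\<^esub> succ \<omega> x y)"
  fix \<alpha> \<beta> x y z
  assume idx: "\<alpha> \<in> \<Omega>" "\<beta> \<in> \<Omega>"
    and car: "x \<in> carrier M" "y \<in> carrier M" "z \<in> carrier M"
  note [simp] = car linear_endo_closed[OF linear_p]
  have [simp]:
    "prec \<omega> a b \<in> carrier M" "bullet \<omega> a b \<in> carrier M" "succ \<omega> a b \<in> carrier M"
    if "\<omega> \<in> \<Omega>" "a \<in> carrier M" "b \<in> carrier M" for \<omega> a b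
    using that bilinear_prec bilinear_bullet bilinear_succ by (auto intro: bilinear_op_closed)
  note biadditive =
    bilinear_op_add_left[OF bilinear_prec] bilinear_op_add_left[OF bilinear_bullet]
    bilinear_op_add_left[OF bilinear_succ]
    bilinear_op_add_right[OF bilinear_prec] bilinear_op_add_right[OF bilinear_bullet]
    bilinear_op_add_right[OF bilinear_succ]
  \<comment> \<open>As in the dendriform case, products \<open>(x \<star> y) \<succ> p z\<close> stay as they are, since only their
    combination in the axiom for \<open>\<succ>\<succ>\<close> can be rewritten.\<close>
  have left: "dot \<nu> (dot \<mu> x y) (p z) =
      prec \<mu> (p x) (prec \<nu> y z) \<oplus>\<^bsub>M\<^esub> prec \<nu> (p x) (succ \<mu> y z) \<oplus>\<^bsub>M\<^esub> prec \<mu> (p x) (bullet \<nu> y z)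
      \<oplus>\<^bsub>M\<^esub> succ \<mu> (p x) (prec \<nu> y z) \<oplus>\<^bsub>M\<^esub> bullet \<mu> (p x) (prec \<nu> y z)
      \<oplus>\<^bsub>M\<^esub> bullet \<nu> (p x) (succ \<mu> y z) \<oplus>\<^bsub>M\<^esub> succ \<mu> (p x) (bullet \<nu> y z)
      \<oplus>\<^bsub>M\<^esub> bullet \<mu> (p x) (bullet \<nu> y z)
      \<oplus>\<^bsub>M\<^esub> succ \<nu> (prec \<mu> x y) (p z) \<oplus>\<^bsub>M\<^esub> succ \<nu> (succ \<mu> x y) (p z)
      \<oplus>\<^bsub>M\<^esub> succ \<nu> (bullet \<mu> x y) (p z)"
    if "\<mu> \<in> \<Omega>" "\<nu> \<in> \<Omega>" for \<mu> \<nu>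
    using that
    by (simp add: dot_def biadditive prec_prec succ_prec bullet_prec prec_bullet succ_bullet
        bullet_bullet M.a_ac)
  have right: "dot \<mu> (p x) (dot \<nu> y z) =
      prec \<mu> (p x) (prec \<nu> y z) \<oplus>\<^bsub>M\<^esub> prec \<mu> (p x) (succ \<nu> y z) \<oplus>\<^bsub>M\<^esub> prec \<mu> (p x) (bullet \<nu> y z)
      \<oplus>\<^bsub>M\<^esub> succ \<mu> (p x) (prec \<nu> y z) \<oplus>\<^bsub>M\<^esub> bullet \<mu> (p x) (prec \<nu> y z)
      \<oplus>\<^bsub>M\<^esub> bullet \<mu> (p x) (succ \<nu> y z) \<oplus>\<^bsub>M\<^esub> succ \<mu> (p x) (bullet \<nu> y z)
      \<oplus>\<^bsub>M\<^esub> bullet \<mu> (p x) (bullet \<nu> y z)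
      \<oplus>\<^bsub>M\<^esub> succ \<mu> (prec \<nu> x y) (p z) \<oplus>\<^bsub>M\<^esub> succ \<nu> (succ \<mu> x y) (p z)
      \<oplus>\<^bsub>M\<^esub> succ \<mu> (bullet \<nu> x y) (p z)"
    if "\<mu> \<in> \<Omega>" "\<nu> \<in> \<Omega>" for \<mu> \<nu>
    using that by (simp add: dot_def biadditive succ_succ M.a_ac)
  show "dot \<beta> (dot \<alpha> x y) (p z) \<oplus>\<^bsub>M\<^esub> dot \<alpha> (dot \<beta> x y) (p z) =
      dot \<alpha> (p x) (dot \<beta> y z) \<oplus>\<^bsub>M\<^esub> dot \<beta> (p x) (dot \<alpha> y z)"
    using idx by (simp add: left right M.a_ac)
qed

theorem theorem4p6:
  fixes R :: "('r, 'x) ring_scheme"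
    and M :: "('r, 'a, 'm) module_scheme"
    and \<Omega> :: "'i set"
    and p :: "'a \<Rightarrow> 'a"
  assumes "cring R" and "module R M" and "\<Omega> \<noteq> {}"
  shows "(\<forall>prec succ.
            matching_Hom_dendriform_algebra R M \<Omega> prec succ p \<longrightarrow>
            compatible_Hom_associative_algebra R M \<Omega>
              (\<lambda>\<omega> x y. prec \<omega> x y \<oplus>\<^bsub>M\<^esub> succ \<omega> x y) p)
       \<and> (\<forall>prec bullet succ.
            matching_Hom_tridendriform_algebra R M \<Omega> prec bullet succ p \<longrightarrow>
            compatible_Hom_associative_algebra R M \<Omega>
              (\<lambda>\<omega> x y. prec \<omega> x y \<oplus>\<^bsub>M\<^esub> bullet \<omega> x y \<oplus>\<^bsub>M\<^esub> succ \<omega> x y) p)"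
  by (simp add: matching_Hom_dendriform_algebra.compatible_Hom_associative_sum
      matching_Hom_tridendriform_algebra.compatible_Hom_associative_sum)

end
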